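(* Let $P=\mathbb R^+\times\mathbb R^+$ with coordinates $(\alpha,\beta)$ carry the Fisher--Rao metric of the Pareto family, \[ g=\frac{\beta^2}{\alpha^2}\,\mathrm d\alpha\otimes\mathrm d\alpha+\frac{1}{\beta^2}\,\mathrm d\beta\otimes\mathrm d\beta , \] and let $F:P\to H$, $F(\alpha,\beta)=(\log\alpha,1/\beta)$. Let $(\alpha_0,\beta_0)\in P$ and $\theta_0\in\mathbb R$. The unit-speed geodesic of $(P,g)$ starting at $(\alpha_0,\beta_0)$ whose image under $F$ has initial velocity making angle $\theta_0$ with the positive $x$-axis in $H$ is \[ \alpha(t)=\alpha_0\exp\left(\frac{\sinh t\,\cos\theta_0}{\beta(t)}\right),\qquad \beta(t)=\beta_0\left(e^{t}\sin^2\left(\frac{\pi}{4}-\frac{\theta_0}{2}\right)+e^{-t}\cos^2\left(\frac{\pi}{4}-\frac{\theta_0}{2}\right)\right). \]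
   Context: Here $\mathbb R^+=(0,\infty)$ and $(\alpha,\beta)$ represents the Pareto density $\beta\alpha^\beta x^{-\beta-1}I_{[x\ge\alpha]}$. $H=\{(x,y)\in\mathbb R^2:y>0\}$ is the Poincaré upper half-plane with metric $h=(\mathrm dx\otimes\mathrm dx+\mathrm dy\otimes\mathrm dy)/y^2$. A tangent vector to $H$ makes angle $\theta_0$ with the positive $x$-axis if it is a positive multiple of $\cos\theta_0\,\partial_x+\sin\theta_0\,\partial_y$. Geodesics are those of the Levi-Civita connection. *)

theory Defs
  imports "HOL-Analysis.Analysis" "HOL-Real_Asymp.Real_Asymp"
begin

section \<open>Riemannian metrics in one global coordinate chart\<close>

text \<open>A Riemannian metric on an open subset of \<open>real ^ 'n\<close> is given by its Gram matrix
  \<open>G p\<close> in the coordinate frame.\<close>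

definition partial_deriv :: "'n::finite \<Rightarrow> (real ^ 'n \<Rightarrow> real) \<Rightarrow> real ^ 'n \<Rightarrow> real" where
  "partial_deriv i f p = deriv (\<lambda>s. f (p + s *\<^sub>R axis i 1)) 0"

definition metric_inner :: "(real ^ 'n \<Rightarrow> real ^ 'n ^ 'n) \<Rightarrow> real ^ 'n \<Rightarrow> real ^ 'n \<Rightarrow> real ^ 'n \<Rightarrow> real" where
  "metric_inner G p v w = (\<Sum>i\<in>UNIV. \<Sum>j\<in>UNIV. G p $ i $ j * v $ i * w $ j)"

text \<open>\<open>christoffel G p k i j\<close> is the Christoffel symbol with upper index \<open>k\<close> and lower indices
  \<open>i\<close>, \<open>j\<close>.\<close>

definition christoffel ::
  "(real ^ 'n \<Rightarrow> real ^ 'n ^ 'n) \<Rightarrow> real ^ 'n \<Rightarrow> 'n::finite \<Rightarrow> 'n \<Rightarrow> 'n \<Rightarrow> real" where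
  "christoffel G p k i j =
     (1/2) * (\<Sum>l\<in>UNIV. matrix_inv (G p) $ k $ l *
        (partial_deriv i (\<lambda>q. G q $ j $ l) p + partial_deriv j (\<lambda>q. G q $ i $ l) p
          - partial_deriv l (\<lambda>q. G q $ i $ j) p))"

text \<open>The Levi-Civita connection, as the torsion-free metric connection: \<open>\<Gamma> p k i j\<close> is the
  \<open>k\<close>-th component of the covariant derivative of the \<open>j\<close>-th coordinate field along the
  \<open>i\<close>-th one. On an open set, for a symmetric invertible
  Gram matrix, its coefficients are exactly the Christoffel symbols (see below).\<close>

definition levi_civita_coeffs ::
  "(real ^ 'n) set \<Rightarrow> (real ^ 'n \<Rightarrow> real ^ 'n ^ 'n) \<Rightarrow>
    (real ^ 'n \<Rightarrow> 'n::finite \<Rightarrow> 'n \<Rightarrow> 'n \<Rightarrow> real) \<Rightarrow> bool" where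
  "levi_civita_coeffs U G \<Gamma> \<longleftrightarrow>
     (\<forall>p\<in>U. (\<forall>k i j. \<Gamma> p k i j = \<Gamma> p k j i) \<and>
        (\<forall>m i j. partial_deriv m (\<lambda>q. G q $ i $ j) p =
           (\<Sum>l\<in>UNIV. \<Gamma> p l m i * G p $ l $ j) + (\<Sum>l\<in>UNIV. \<Gamma> p l m j * G p $ i $ l)))"

lemma partial_deriv_cong:
  assumes "open U" "p \<in> U" "\<And>q. q \<in> U \<Longrightarrow> f q = g q"
  shows "partial_deriv i f p = partial_deriv i g p"
proof -
  have "continuous (at 0) (\<lambda>s. p + s *\<^sub>R axis i (1::real))"
    by (intro continuous_intros)
  then have "((\<lambda>s. p + s *\<^sub>R axis i (1::real)) \<longlongrightarrow> p) (nhds 0)"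
    using tendsto_at_iff_tendsto_nhds[of "\<lambda>s. p + s *\<^sub>R axis i (1::real)" 0]
    by (simp add: continuous_at)
  then have "\<forall>\<^sub>F s in nhds 0. p + s *\<^sub>R axis i 1 \<in> U"
    using assms(1,2) by (rule topological_tendstoD)
  then have "\<forall>\<^sub>F s in nhds 0. f (p + s *\<^sub>R axis i 1) = g (p + s *\<^sub>R axis i 1)"
    by eventually_elim (use assms(3) in auto)
  then show ?thesis
    unfolding partial_deriv_def by (intro deriv_cong_ev) auto
qed

lemma levi_civita_coeffs_iff_christoffel:
  fixes G :: "real ^ 'n \<Rightarrow> real ^ 'n ^ 'n"
  assumes U: "open U" and sym: "\<And>p. p \<in> U \<Longrightarrow> transpose (G p) = G p"
    and inv: "\<And>p. p \<in> U \<Longrightarrow> invertible (G p)"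
  shows "levi_civita_coeffs U G \<Gamma> \<longleftrightarrow> (\<forall>p\<in>U. \<forall>k i j. \<Gamma> p k i j = christoffel G p k i j)"
proof -
  have symG: "G p $ i $ j = G p $ j $ i" if "p \<in> U" for p i j
    using arg_cong[OF sym[OF that], of "\<lambda>M. M $ j $ i"] by (simp add: transpose_def)
  have main: "((\<forall>k i j. \<Gamma> p k i j = \<Gamma> p k j i) \<and>
        (\<forall>m i j. partial_deriv m (\<lambda>q. G q $ i $ j) p =
           (\<Sum>l\<in>UNIV. \<Gamma> p l m i * G p $ l $ j) + (\<Sum>l\<in>UNIV. \<Gamma> p l m j * G p $ i $ l)))
      \<longleftrightarrow> (\<forall>k i j. \<Gamma> p k i j = christoffel G p k i j)" (is "?L \<longleftrightarrow> ?R") if p: "p \<in> U" for p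
  proof -
    have inverse: "G p ** matrix_inv (G p) = mat 1" "matrix_inv (G p) ** G p = mat 1"
      using someI_ex[OF inv[OF p, unfolded invertible_def]] by (auto simp: matrix_inv_def)
    define D where "D m i j = partial_deriv m (\<lambda>q. G q $ i $ j) p" for m i j
    define A where "A l i j = (D i j l + D j i l - D l i j) / 2" for l i j
    have Dsym: "D m i j = D m j i" for m i j
      unfolding D_def by (rule partial_deriv_cong[OF U p]) (simp add: symG)
    have chr: "christoffel G p k i j = (\<Sum>l\<in>UNIV. matrix_inv (G p) $ k $ l * A l i j)" for k i j
      unfolding christoffel_def A_def D_def by (simp add: sum_distrib_left)
    have lower: "(\<forall>k. \<Gamma> p k i j = christoffel G p k i j) \<longleftrightarrow>
        (\<forall>k. (\<Sum>l\<in>UNIV. G p $ k $ l * \<Gamma> p l i j) = A k i j)" for i j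
    proof -
      have "G p *v (\<chi> k. \<Gamma> p k i j) = (\<chi> k. A k i j) \<longleftrightarrow>
          (\<chi> k. \<Gamma> p k i j) = matrix_inv (G p) *v (\<chi> k. A k i j)"
        using inverse
        by (metis matrix_vector_mul_assoc matrix_vector_mul_lid)
      then show ?thesis
        by (auto simp: vec_eq_iff matrix_vector_mult_def chr)
    qed
    define L where "L k i j = (\<Sum>l\<in>UNIV. G p $ k $ l * \<Gamma> p l i j)" for k i j
    have R: "?R \<longleftrightarrow> (\<forall>k i j. L k i j = A k i j)"
      unfolding L_def using lower by blast
    have comp: "(\<Sum>l\<in>UNIV. \<Gamma> p l m i * G p $ l $ j) + (\<Sum>l\<in>UNIV. \<Gamma> p l m j * G p $ i $ l)
        = L j m i + L i m j" for m i j
      unfolding L_def by (simp add: symG[OF p, of _ j] mult.commute)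
    have "?L \<longleftrightarrow> (\<forall>k i j. \<Gamma> p k i j = \<Gamma> p k j i) \<and> (\<forall>m i j. D m i j = L j m i + L i m j)"
      unfolding comp D_def ..
    also have "\<dots> \<longleftrightarrow> (\<forall>k i j. L k i j = A k i j)"
    proof
      assume *: "(\<forall>k i j. \<Gamma> p k i j = \<Gamma> p k j i) \<and> (\<forall>m i j. D m i j = L j m i + L i m j)"
      then have Lsym: "L k i j = L k j i" for k i j
        unfolding L_def by metis
      have D: "D m i j = L j m i + L i m j" for m i j
        using * by blast
      show "\<forall>k i j. L k i j = A k i j"
      proof (intro allI)
        fix k i j
        show "L k i j = A k i j"
          using Lsym[of k i j] Lsym[of j i k] Lsym[of i j k] by (simp add: A_def D)
      qed
    next
      assume *: "\<forall>k i j. L k i j = A k i j"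
      then have "?R" using R by blast
      moreover have Asym: "A l i j = A l j i" for l i j
        unfolding A_def by (simp add: Dsym[of l i j])
      ultimately have "\<forall>k i j. \<Gamma> p k i j = \<Gamma> p k j i"
        by (metis (no_types, lifting) chr sum.cong)
      moreover have "D m i j = L j m i + L i m j" for m i j
        using Dsym[of m i j] Dsym[of i m j] Dsym[of j m i] by (simp add: * A_def field_simps)
      ultimately show "(\<forall>k i j. \<Gamma> p k i j = \<Gamma> p k j i) \<and> (\<forall>m i j. D m i j = L j m i + L i m j)"
        by blast
    qed
    finally show ?thesis unfolding R .
  qed
  show ?thesis
    unfolding levi_civita_coeffs_def using main by (intro ball_cong) auto
qed


section \<open>Geodesics\<close>

abbreviation velocity :: "(real \<Rightarrow> real ^ 'n) \<Rightarrow> real \<Rightarrow> real ^ 'n" where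
  "velocity c t \<equiv> vector_derivative c (at t)"

text \<open>The parameter set \<open>I\<close> is meant to be an open interval. Twice differentiable solutions of
  the geodesic equation are automatically smooth when the metric is.\<close>

definition geodesic_on ::
  "(real ^ 'n) set \<Rightarrow> (real ^ 'n \<Rightarrow> real ^ 'n ^ 'n) \<Rightarrow> real set \<Rightarrow> (real \<Rightarrow> real ^ 'n::finite) \<Rightarrow> bool" where
  "geodesic_on U G I c \<longleftrightarrow>
     (\<forall>t\<in>I. c t \<in> U \<and> c differentiable (at t) \<and> velocity c differentiable (at t) \<and>
       (\<forall>k. velocity (velocity c) t $ k +
          (\<Sum>i\<in>UNIV. \<Sum>j\<in>UNIV. christoffel G (c t) k i j * velocity c t $ i * velocity c t $ j) = 0))"

definition unit_speed_on ::
  "(real ^ 'n \<Rightarrow> real ^ 'n ^ 'n) \<Rightarrow> real set \<Rightarrow> (real \<Rightarrow> real ^ 'n::finite) \<Rightarrow> bool" where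
  "unit_speed_on G I c \<longleftrightarrow> (\<forall>t\<in>I. metric_inner G (c t) (velocity c t) (velocity c t) = 1)"


section \<open>The Pareto family\<close>

text \<open>Points are \<open>vector [\<alpha>, \<beta>]\<close>.\<close>

definition pareto_space :: "(real ^ 2) set" where
  "pareto_space = {p. p $ 1 > 0 \<and> p $ 2 > 0}"

definition pareto_metric :: "real ^ 2 \<Rightarrow> real ^ 2 ^ 2" where
  "pareto_metric p = vector [vector [(p $ 2)\<^sup>2 / (p $ 1)\<^sup>2, 0], vector [0, 1 / (p $ 2)\<^sup>2]]"

definition pareto_density :: "real ^ 2 \<Rightarrow> real \<Rightarrow> real" where
  "pareto_density p x = p $ 2 * p $ 1 powr p $ 2 * x powr (- p $ 2 - 1) * indicator {p $ 1..} x"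

definition fisher_information :: "(real ^ 'n \<Rightarrow> real \<Rightarrow> real) \<Rightarrow> real ^ 'n \<Rightarrow> real ^ 'n::finite ^ 'n" where
  "fisher_information f p =
     (\<chi> i j. LINT x|lborel. partial_deriv i (\<lambda>q. ln (f q x)) p * partial_deriv j (\<lambda>q. ln (f q x)) p * f p x)"

definition upper_half_plane :: "(real ^ 2) set" where
  "upper_half_plane = {z. z $ 2 > 0}"

definition pareto_to_half_plane :: "real ^ 2 \<Rightarrow> real ^ 2" where
  "pareto_to_half_plane p = vector [ln (p $ 1), 1 / p $ 2]"

definition makes_angle :: "real \<Rightarrow> real ^ 2 \<Rightarrow> bool" where
  "makes_angle \<theta> v \<longleftrightarrow> (\<exists>r>0. v = r *\<^sub>R vector [cos \<theta>, sin \<theta>])"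

lemma pareto_to_half_plane_in:
  "p \<in> pareto_space \<Longrightarrow> pareto_to_half_plane p \<in> upper_half_plane"
  by (simp add: pareto_space_def pareto_to_half_plane_def upper_half_plane_def)

lemma open_pareto_space: "open pareto_space"
proof -
  have eq: "pareto_space = {p. p $ 1 > 0} \<inter> {p. p $ 2 > 0}"
    by (auto simp: pareto_space_def)
  show ?thesis
    unfolding eq by (intro open_Int open_Collect_less continuous_intros)
qed

lemma transpose_pareto_metric: "transpose (pareto_metric p) = pareto_metric p"
  by (simp add: pareto_metric_def transpose_def vec_eq_iff forall_2)

lemma invertible_pareto_metric: "p \<in> pareto_space \<Longrightarrow> invertible (pareto_metric p)"
  by (simp add: pareto_space_def pareto_metric_def invertible_det_nz det_2)

lemma FTC_at_top:
  fixes f F :: "real \<Rightarrow> real"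
  assumes [measurable]: "f \<in> borel_measurable borel"
    and "\<And>x. a \<le> x \<Longrightarrow> DERIV F x :> f x" "\<And>x. a \<le> x \<Longrightarrow> 0 \<le> f x" "(F \<longlongrightarrow> 0) at_top"
  shows "has_bochner_integral lborel (\<lambda>x. f x * indicator {a..} x) (- F a)"
proof -
  have "integral\<^sup>N lborel (\<lambda>x. ennreal (f x) * indicator {a..} x) = ennreal (0 - F a)"
    by (rule nn_integral_FTC_atLeast) (use assms in auto)
  moreover have "F a \<le> 0"
  proof (rule tendsto_lowerbound[OF assms(4)])
    show "\<forall>\<^sub>F x in at_top. F a \<le> F x"
      using eventually_ge_at_top[of a]
      by eventually_elim (rule DERIV_nonneg_imp_nondecreasing, use assms in auto)
  qed simp
  moreover have "(\<lambda>x. ennreal (f x) * indicator {a..} x) = (\<lambda>x. ennreal (f x * indicator {a..} x))"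
    by (auto simp: indicator_def)
  ultimately show ?thesis
    by (intro has_bochner_integral_nn_integral) (use assms(3) in \<open>auto simp: indicator_def\<close>)
qed

lemma pareto_moments:
  fixes a b :: real
  assumes "a > 0" "b > 0"
  defines "f \<equiv> \<lambda>x. b / x * (a / x) powr b"
  shows "has_bochner_integral lborel (\<lambda>x. f x * indicator {a..} x) 1"
    and "has_bochner_integral lborel (\<lambda>x. ln (x / a) * f x * indicator {a..} x) (1 / b)"
    and "has_bochner_integral lborel (\<lambda>x. (1 / b - ln (x / a))\<^sup>2 * f x * indicator {a..} x) (1 / b\<^sup>2)"
proof -
  have f0: "f x \<ge> 0" if "a \<le> x" for x
    using assms that by (simp add: f_def)
  define E where "E x = (a / x) powr b" for x
  have dE: "(E has_real_derivative - f x) (at x)" if "a \<le> x" for x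
    unfolding E_def f_def using assms that
    by (auto intro!: derivative_eq_intros simp: field_simps powr_diff power2_eq_square)
  have dl: "((\<lambda>x. ln (x / a)) has_real_derivative 1 / x) (at x)" if "a \<le> x" for x
    using assms(1) that by (auto intro!: derivative_eq_intros simp: field_simps)
  have fE: "f x = b * E x / x" for x
    by (simp add: f_def E_def)
  have Ea: "E a = 1"
    using assms by (simp add: E_def)
  have [measurable]: "f \<in> borel_measurable borel"
    unfolding f_def by measurable
  have "has_bochner_integral lborel (\<lambda>x. f x * indicator {a..} x) (- (- E a))"
  proof (rule FTC_at_top[where F = "\<lambda>x. - E x"])
    show "((\<lambda>x. - E x) has_real_derivative f x) (at x)" if "a \<le> x" for x
      using DERIV_minus[OF dE[OF that]] by simp
    show "((\<lambda>x. - E x) \<longlongrightarrow> 0) at_top"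
      unfolding E_def using assms(1,2) by real_asymp
  qed (use f0 in auto)
  then show "has_bochner_integral lborel (\<lambda>x. f x * indicator {a..} x) 1"
    by (simp add: Ea)
  have "has_bochner_integral lborel (\<lambda>x. ln (x / a) * f x * indicator {a..} x)
      (- (- (ln (a / a) + 1 / b) * E a))"
  proof (rule FTC_at_top[where F = "\<lambda>x. - (ln (x / a) + 1 / b) * E x"])
    show "((\<lambda>x. - (ln (x / a) + 1 / b) * E x) has_real_derivative ln (x / a) * f x) (at x)"
      if "a \<le> x" for x
      by (rule DERIV_cong[OF DERIV_mult[OF DERIV_minus[OF DERIV_add[OF dl[OF that] DERIV_const]] dE[OF that]]])
        (use that assms(1,2) in \<open>simp add: fE field_simps\<close>)
    show "((\<lambda>x. - (ln (x / a) + 1 / b) * E x) \<longlongrightarrow> 0) at_top"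
      unfolding E_def using assms(1,2) by real_asymp
  qed (use f0 assms(1) in auto)
  then show "has_bochner_integral lborel (\<lambda>x. ln (x / a) * f x * indicator {a..} x) (1 / b)"
    using assms(1) by (simp add: Ea)
  have "has_bochner_integral lborel (\<lambda>x. (1 / b - ln (x / a))\<^sup>2 * f x * indicator {a..} x)
      (- (- ((ln (a / a))\<^sup>2 + 1 / b\<^sup>2) * E a))"
  proof (rule FTC_at_top[where F = "\<lambda>x. - ((ln (x / a))\<^sup>2 + 1 / b\<^sup>2) * E x"])
    show "((\<lambda>x. - ((ln (x / a))\<^sup>2 + 1 / b\<^sup>2) * E x) has_real_derivative
        (1 / b - ln (x / a))\<^sup>2 * f x) (at x)"
      if "a \<le> x" for x
      by (rule DERIV_cong[OF DERIV_mult[OF DERIV_minus[OF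
              DERIV_add[OF DERIV_power[OF dl[OF that]] DERIV_const]] dE[OF that]]])
        (use that assms(1,2) in \<open>simp add: fE field_simps power2_eq_square\<close>)
    show "((\<lambda>x. - ((ln (x / a))\<^sup>2 + 1 / b\<^sup>2) * E x) \<longlongrightarrow> 0) at_top"
      unfolding E_def using assms(1,2) by real_asymp
  qed (use f0 assms(1) in auto)
  then show "has_bochner_integral lborel (\<lambda>x. (1 / b - ln (x / a))\<^sup>2 * f x * indicator {a..} x) (1 / b\<^sup>2)"
    using assms(1) by (simp add: Ea)
qed

lemma fisher_information_pareto:
  assumes "p \<in> pareto_space"
  shows "fisher_information pareto_density p = pareto_metric p"
proof -
  define a b where "a = p $ 1" and "b = p $ 2"
  have a: "a > 0" and b: "b > 0"
    using assms by (auto simp: a_def b_def pareto_space_def)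
  define f where "f x = b / x * (a / x) powr b" for x
  note moments = pareto_moments[OF a b, folded f_def]
  have dens: "pareto_density p x = f x * indicator {a..} x" for x
    using a b by (auto simp: pareto_density_def f_def indicator_def powr_divide powr_diff powr_minus
        field_simps simp flip: a_def b_def)
  have ln_dens: "ln (pareto_density q x) = ln (q $ 2) + q $ 2 * ln (q $ 1) - (q $ 2 + 1) * ln x"
    if "q $ 1 > 0" "q $ 2 > 0" "q $ 1 < x" for q x
    using that by (simp add: pareto_density_def ln_mult ln_powr algebra_simps)
  have ax: "(p + s *\<^sub>R axis 1 1) $ 1 = a + s" "(p + s *\<^sub>R axis 1 1) $ 2 = b"
      "(p + s *\<^sub>R axis 2 1) $ 1 = a" "(p + s *\<^sub>R axis 2 1) $ 2 = b + s" for s :: real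
    by (auto simp: a_def b_def axis_def)
  have s1: "partial_deriv 1 (\<lambda>q. ln (pareto_density q x)) p = b / a" if x: "a < x" for x
  proof -
    have "\<forall>\<^sub>F s in nhds 0. s \<in> {- a<..<x - a}"
      using a x by (intro eventually_nhds_in_open) auto
    then have "\<forall>\<^sub>F s in nhds 0. ln (pareto_density (p + s *\<^sub>R axis 1 1) x)
        = ln b + b * ln (a + s) - (b + 1) * ln x"
      by eventually_elim (use b in \<open>subst ln_dens, auto simp: ax simp del: vector_add_component vector_scaleR_component\<close>)
    then have "partial_deriv 1 (\<lambda>q. ln (pareto_density q x)) p
        = deriv (\<lambda>s. ln b + b * ln (a + s) - (b + 1) * ln x) 0"
      unfolding partial_deriv_def by (intro deriv_cong_ev) auto
    also have "\<dots> = b / a"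
      by (rule DERIV_imp_deriv) (use a in \<open>auto intro!: derivative_eq_intros\<close>)
    finally show ?thesis .
  qed
  have s2: "partial_deriv 2 (\<lambda>q. ln (pareto_density q x)) p = 1 / b - ln (x / a)" if x: "a < x" for x
  proof -
    have "\<forall>\<^sub>F s in nhds 0. s \<in> {- b<..}"
      using b by (intro eventually_nhds_in_open) auto
    then have "\<forall>\<^sub>F s in nhds 0. ln (pareto_density (p + s *\<^sub>R axis 2 1) x)
        = ln (b + s) + (b + s) * ln a - (b + s + 1) * ln x"
      by eventually_elim (use a x in \<open>subst ln_dens, auto simp: ax simp del: vector_add_component vector_scaleR_component\<close>)
    then have "partial_deriv 2 (\<lambda>q. ln (pareto_density q x)) p
        = deriv (\<lambda>s. ln (b + s) + (b + s) * ln a - (b + s + 1) * ln x) 0"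
      unfolding partial_deriv_def by (intro deriv_cong_ev) auto
    also have "\<dots> = 1 / b - ln (x / a)"
      by (rule DERIV_imp_deriv) (use a b x in \<open>auto intro!: derivative_eq_intros simp: ln_div\<close>)
    finally show ?thesis .
  qed
  define S where "S i x = (if i = 1 then b / a else 1 / b - ln (x / a))" for i :: 2 and x
  have S: "partial_deriv i (\<lambda>q. ln (pareto_density q x)) p = S i x" if "a < x" for i x
    using s1[OF that] s2[OF that] exhaust_2[of i] by (auto simp: S_def)
  have entry: "fisher_information pareto_density p $ i $ j
      = (LINT x|lborel. S i x * S j x * (f x * indicator {a..} x))" for i j
    unfolding fisher_information_def vec_lambda_beta
    by (rule integral_discrete_difference[of "{a}"])
      (auto simp: dens S indicator_def)
  have "(LINT x|lborel. S 1 x * S 1 x * (f x * indicator {a..} x)) = b\<^sup>2 / a\<^sup>2"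
    using has_bochner_integral_mult_right[OF moments(1), of "b\<^sup>2 / a\<^sup>2"]
    by (simp add: S_def has_bochner_integral_iff power2_eq_square mult.assoc)
  moreover have "(LINT x|lborel. S 2 x * S 2 x * (f x * indicator {a..} x)) = 1 / b\<^sup>2"
    using moments(3)
    by (simp add: S_def has_bochner_integral_iff power2_eq_square mult.assoc)
  moreover have S12: "(LINT x|lborel. S 1 x * S 2 x * (f x * indicator {a..} x)) = 0"
  proof -
    have "has_bochner_integral lborel
        (\<lambda>x. b / a * (1 / b * (f x * indicator {a..} x) - ln (x / a) * f x * indicator {a..} x))
        (b / a * (1 / b * 1 - 1 / b))"
      by (intro has_bochner_integral_mult_right has_bochner_integral_diff moments)
    moreover have "(\<lambda>x. b / a * (1 / b * (f x * indicator {a..} x) - ln (x / a) * f x * indicator {a..} x))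
        = (\<lambda>x. S 1 x * S 2 x * (f x * indicator {a..} x))"
      by (auto simp: S_def algebra_simps)
    ultimately have "has_bochner_integral lborel
        (\<lambda>x. S 1 x * S 2 x * (f x * indicator {a..} x)) (b / a * (1 / b * 1 - 1 / b))"
      by (simp only:)
    then show ?thesis
      by (simp add: has_bochner_integral_iff)
  qed
  moreover have "(LINT x|lborel. S 2 x * S 1 x * (f x * indicator {a..} x)) = 0"
    using S12 by (simp add: mult.commute mult.left_commute)
  ultimately show ?thesis
    by (simp add: vec_eq_iff forall_2 entry pareto_metric_def flip: a_def b_def)
qed

end

theory Submission
  imports Defs
begin

text \<open>Along a unit-speed curve the second geodesic equation
  \<open>b'' = b (b\<^sup>2 a'\<^sup>2 / a\<^sup>2 + b'\<^sup>2 / b\<^sup>2)\<close> becomes the linear equation \<open>b'' = b\<close>, so \<open>b\<close> is determined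
  by its initial data. The first one says that \<open>(a' / a) b\<^sup>2\<close> is constant, which then determines
  \<open>ln a\<close>; its closed form comes from the Wronskian \<open>\<beta> cosh - \<beta>' sinh\<close> of two solutions of
  \<open>b'' = b\<close> being constant.\<close>

section \<open>Componentwise differentiation of curves\<close>

lemma vector_2_eq_axis: "vector [x, y] = x *\<^sub>R axis 1 1 + y *\<^sub>R (axis 2 1 :: real ^ 2)"
  by (simp add: vec_eq_iff forall_2 axis_def)

lemma has_vector_derivative_vector_2:
  assumes "(f has_real_derivative f') F" "(g has_real_derivative g') F"
  shows "((\<lambda>t. vector [f t, g t] :: real ^ 2) has_vector_derivative vector [f', g']) F"
  unfolding vector_2_eq_axis
  using assms unfolding has_real_derivative_iff_has_vector_derivative
  by (intro has_vector_derivative_add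
      bounded_linear.has_vector_derivative[OF bounded_linear_scaleR_left])

lemma has_vector_derivative_vec_nth:
  fixes c :: "real \<Rightarrow> real ^ 'n"
  assumes "(c has_vector_derivative v) F"
  shows "((\<lambda>t. c t $ i) has_real_derivative v $ i) F"
  using bounded_linear.has_vector_derivative[OF bounded_linear_vec_nth assms]
  by (simp add: has_real_derivative_iff_has_vector_derivative)

section \<open>Christoffel symbols and geodesic equations of the Pareto metric\<close>

lemma partial_deriv_const: "partial_deriv i (\<lambda>q. k) p = 0"
  by (simp add: partial_deriv_def)

lemma partial_deriv_pareto_metric:
  assumes "p \<in> pareto_space"
  shows "partial_deriv 1 (\<lambda>q. pareto_metric q $ 1 $ 1) p = - 2 * (p $ 2)\<^sup>2 / (p $ 1) ^ 3"
    and "partial_deriv 2 (\<lambda>q. pareto_metric q $ 1 $ 1) p = 2 * p $ 2 / (p $ 1)\<^sup>2"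
    and "partial_deriv 1 (\<lambda>q. pareto_metric q $ 2 $ 2) p = 0"
    and "partial_deriv 2 (\<lambda>q. pareto_metric q $ 2 $ 2) p = - 2 / (p $ 2) ^ 3"
  using assms unfolding partial_deriv_def pareto_space_def
  by - ((rule DERIV_imp_deriv; simp add: pareto_metric_def axis_def;
      auto intro!: derivative_eq_intros simp: field_simps power2_eq_square power3_eq_cube)+)

lemma christoffel_pareto:
  assumes p: "p \<in> pareto_space"
  shows "christoffel pareto_metric p 1 1 1 = - 1 / p $ 1"
    and "christoffel pareto_metric p 1 1 2 = 1 / p $ 2"
    and "christoffel pareto_metric p 1 2 1 = 1 / p $ 2"
    and "christoffel pareto_metric p 1 2 2 = 0"
    and "christoffel pareto_metric p 2 1 1 = - ((p $ 2) ^ 3 / (p $ 1)\<^sup>2)"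
    and "christoffel pareto_metric p 2 1 2 = 0"
    and "christoffel pareto_metric p 2 2 1 = 0"
    and "christoffel pareto_metric p 2 2 2 = - 1 / p $ 2"
proof -
  have pos: "p $ 1 > 0" "p $ 2 > 0"
    using p by (auto simp: pareto_space_def)
  define M :: "real ^ 2 ^ 2" where
    "M = vector [vector [(p $ 1)\<^sup>2 / (p $ 2)\<^sup>2, 0], vector [0, (p $ 2)\<^sup>2]]"
  have "pareto_metric p ** M = mat 1"
    using pos
    by (simp add: M_def pareto_metric_def matrix_matrix_mult_def vec_eq_iff forall_2 sum_2 mat_def)
  moreover have "matrix_inv (pareto_metric p) ** pareto_metric p = mat 1"
    using someI_ex[OF invertible_pareto_metric[OF p, unfolded invertible_def]]
    by (simp add: matrix_inv_def)
  \<comment> \<open>A left inverse and a right inverse of the same matrix coincide.\<close>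
  ultimately have "matrix_inv (pareto_metric p) = M"
    by (metis matrix_mul_assoc matrix_mul_lid matrix_mul_rid)
  then have inv: "matrix_inv (pareto_metric p) $ 1 $ 1 = (p $ 1)\<^sup>2 / (p $ 2)\<^sup>2"
      "matrix_inv (pareto_metric p) $ 1 $ 2 = 0" "matrix_inv (pareto_metric p) $ 2 $ 1 = 0"
      "matrix_inv (pareto_metric p) $ 2 $ 2 = (p $ 2)\<^sup>2"
    by (simp_all add: M_def)
  \<comment> \<open>Stated as equalities of functions so that \<open>partial_deriv_const\<close>
    applies under the partial derivative.\<close>
  have off: "(\<lambda>q. pareto_metric q $ 1 $ 2) = (\<lambda>q. 0)" "(\<lambda>q. pareto_metric q $ 2 $ 1) = (\<lambda>q. 0)"
    by (auto simp: pareto_metric_def)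
  note christoffel_simps = christoffel_def sum_2 inv off partial_deriv_const
    partial_deriv_pareto_metric[OF p]
  show "christoffel pareto_metric p 1 1 1 = - 1 / p $ 1"
    "christoffel pareto_metric p 1 1 2 = 1 / p $ 2"
    "christoffel pareto_metric p 1 2 1 = 1 / p $ 2"
    "christoffel pareto_metric p 1 2 2 = 0"
    "christoffel pareto_metric p 2 1 1 = - ((p $ 2) ^ 3 / (p $ 1)\<^sup>2)"
    "christoffel pareto_metric p 2 1 2 = 0"
    "christoffel pareto_metric p 2 2 1 = 0"
    "christoffel pareto_metric p 2 2 2 = - 1 / p $ 2"
    using pos by (simp_all add: christoffel_simps)
      (simp_all add: field_simps power2_eq_square power3_eq_cube)
qed

lemma metric_inner_pareto:
  "metric_inner pareto_metric p v v = (p $ 2)\<^sup>2 * (v $ 1)\<^sup>2 / (p $ 1)\<^sup>2 + (v $ 2)\<^sup>2 / (p $ 2)\<^sup>2"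
  by (simp add: metric_inner_def sum_2 pareto_metric_def power2_eq_square)

text \<open>Pointwise in position \<open>p\<close>, velocity \<open>v\<close> and acceleration
  \<open>w\<close>, so it serves both to verify the closed form and to analyse an arbitrary
  geodesic.\<close>

lemma geodesic_equations_pareto:
  fixes p v :: "real ^ 2"
  assumes "p \<in> pareto_space"
  shows "(\<forall>k. w $ k + (\<Sum>i\<in>UNIV. \<Sum>j\<in>UNIV. christoffel pareto_metric p k i j * v $ i * v $ j) = 0)
    \<longleftrightarrow> w $ 1 = (v $ 1)\<^sup>2 / p $ 1 - 2 * v $ 1 * v $ 2 / p $ 2 \<and>
        w $ 2 = (p $ 2) ^ 3 / (p $ 1)\<^sup>2 * (v $ 1)\<^sup>2 + (v $ 2)\<^sup>2 / p $ 2"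
  by (simp add: forall_2 sum_2 christoffel_pareto[OF assms] power2_eq_square) argo

text \<open>Replaces \<open>velocity\<close> by explicit derivatives. Since
  \<open>velocity c\<close> is known to equal \<open>v\<close> only on \<open>I\<close>, openness of
  \<open>I\<close> is what allows differentiating it a second time.\<close>

lemma geodesic_onI:
  assumes I: "open I"
    and c: "\<And>t. t \<in> I \<Longrightarrow> c t \<in> U"
    and v: "\<And>t. t \<in> I \<Longrightarrow> (c has_vector_derivative v t) (at t)"
    and w: "\<And>t. t \<in> I \<Longrightarrow> (v has_vector_derivative w t) (at t)"
    and eq: "\<And>t k. t \<in> I \<Longrightarrow> w t $ k +
      (\<Sum>i\<in>UNIV. \<Sum>j\<in>UNIV. christoffel G (c t) k i j * v t $ i * v t $ j) = 0"
  shows "geodesic_on U G I c"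
  unfolding geodesic_on_def
proof
  fix t assume t: "t \<in> I"
  have vel: "velocity c s = v s" if "s \<in> I" for s
    using v[OF that] by (rule vector_derivative_at)
  have "(velocity c has_vector_derivative w t) (at t)"
    using has_vector_derivative_transform_within_open[OF w[OF t] I t] vel by simp
  then show "c t \<in> U \<and> c differentiable (at t) \<and> velocity c differentiable (at t) \<and>
      (\<forall>k. velocity (velocity c) t $ k +
         (\<Sum>i\<in>UNIV. \<Sum>j\<in>UNIV. christoffel G (c t) k i j * velocity c t $ i * velocity c t $ j) = 0)"
    using c[OF t] v[OF t] eq[OF t]
    by (auto simp: vel[OF t] vector_derivative_at intro: differentiableI_vector)
qed

text \<open>The chain rule for \<open>F\<close>; it turns the angle condition in the half-plane into
  conditions on the initial velocity in P.\<close>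

lemma velocity_pareto_to_half_plane:
  assumes c: "(c has_vector_derivative v) (at t)" and p: "c t \<in> pareto_space"
  shows "velocity (pareto_to_half_plane \<circ> c) t = vector [v $ 1 / c t $ 1, - v $ 2 / (c t $ 2)\<^sup>2]"
proof -
  have "((\<lambda>s. vector [ln (c s $ 1), 1 / c s $ 2] :: real ^ 2)
      has_vector_derivative vector [v $ 1 / c t $ 1, - v $ 2 / (c t $ 2)\<^sup>2]) (at t)"
    using p has_vector_derivative_vec_nth[OF c]
    by (intro has_vector_derivative_vector_2)
      (auto intro!: derivative_eq_intros simp: pareto_space_def power2_eq_square)
  then show ?thesis
    by (intro vector_derivative_at) (simp add: pareto_to_half_plane_def o_def)
qed

text \<open>Solutions of \<open>d'' = d\<close> with vanishing initial data vanish, because \<open>exp (- t) (d + d')\<close> and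
  \<open>exp t (d - d')\<close> are constant.\<close>

lemma second_order_linear_unique:
  fixes d e :: "real \<Rightarrow> real"
  assumes I: "convex I" "0 \<in> I" "t \<in> I"
    and d: "\<And>t. t \<in> I \<Longrightarrow> (d has_real_derivative e t) (at t)"
    and e: "\<And>t. t \<in> I \<Longrightarrow> (e has_real_derivative d t) (at t)"
    and init: "d 0 = 0" "e 0 = 0"
  shows "d t = 0" "e t = 0"
proof -
  have "\<exists>k. \<forall>t\<in>I. exp (- t) * (d t + e t) = k"
    by (intro has_field_derivative_zero_constant I)
      (auto intro!: derivative_eq_intros DERIV_subset[OF d] DERIV_subset[OF e] simp: algebra_simps)
  then have plus: "exp (- t) * (d t + e t) = 0"
    using I init by fastforce
  have "\<exists>k. \<forall>t\<in>I. exp t * (d t - e t) = k"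
    by (intro has_field_derivative_zero_constant I)
      (auto intro!: derivative_eq_intros DERIV_subset[OF d] DERIV_subset[OF e] simp: algebra_simps)
  then have "exp t * (d t - e t) = 0"
    using I init by fastforce
  with plus show "d t = 0" "e t = 0"
    by simp_all
qed

text \<open>Twice the half angle is pi/2 - \<theta>, whose cosine is sin \<theta>. The right-hand
  side exhibits \<beta> as a combination of the two basic solutions of b'' = b.\<close>

lemma exp_sin_cos_half_angle:
  fixes t \<theta> :: real
  shows "exp t * (sin (pi / 4 - \<theta> / 2))\<^sup>2 + exp (- t) * (cos (pi / 4 - \<theta> / 2))\<^sup>2
    = cosh t - sin \<theta> * sinh t"
proof -
  have "cos (2 * (pi / 4 - \<theta> / 2)) = sin \<theta>"
    by (simp add: right_diff_distrib cos_diff)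
  then have c: "(cos (pi / 4 - \<theta> / 2))\<^sup>2 = (1 + sin \<theta>) / 2" and s: "(sin (pi / 4 - \<theta> / 2))\<^sup>2 = (1 - sin \<theta>) / 2"
    using cos_double_cos[of "pi / 4 - \<theta> / 2"] cos_double_sin[of "pi / 4 - \<theta> / 2"] by simp_all
  show ?thesis
    unfolding c s by (simp add: cosh_def sinh_def field_simps)
qed

text \<open>Holds because |sin \<theta>| is at most 1 and |sinh t| < cosh t. It keeps \<beta>
  positive for all times.\<close>

lemma cosh_minus_sin_sinh_pos: "cosh t - sin \<theta> * sinh t > 0" for t \<theta> :: real
proof -
  have "\<bar>sin \<theta> * sinh t\<bar> \<le> 1 * \<bar>sinh t\<bar>"
    unfolding abs_mult by (intro mult_right_mono) auto
  also have "\<bar>sinh t\<bar> < cosh t"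
    using sinh_less_cosh_real[of t] sinh_less_cosh_real[of "- t"] by (simp add: abs_if)
  finally show ?thesis by simp
qed

text \<open>Quantifying over every open interval around 0 yields uniqueness even for geodesics
  defined only locally; the case \<open>I = UNIV\<close> shows that the geodesic exists for all
  times.\<close>

theorem mainTheorem4:
  fixes \<alpha>\<^sub>0 \<beta>\<^sub>0 \<theta>\<^sub>0 :: real and \<alpha> \<beta> :: "real \<Rightarrow> real"
  assumes init: "vector [\<alpha>\<^sub>0, \<beta>\<^sub>0] \<in> pareto_space"
    and \<beta>: "\<And>t. \<beta> t = \<beta>\<^sub>0 * (exp t * (sin (pi / 4 - \<theta>\<^sub>0 / 2))\<^sup>2
                            + exp (- t) * (cos (pi / 4 - \<theta>\<^sub>0 / 2))\<^sup>2)"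
    and \<alpha>: "\<And>t. \<alpha> t = \<alpha>\<^sub>0 * exp (sinh t * cos \<theta>\<^sub>0 / \<beta> t)"
  shows "\<forall>I c. open I \<and> is_interval I \<and> 0 \<in> I \<longrightarrow>
     ((geodesic_on pareto_space pareto_metric I c \<and> unit_speed_on pareto_metric I c \<and>
       c 0 = vector [\<alpha>\<^sub>0, \<beta>\<^sub>0] \<and> makes_angle \<theta>\<^sub>0 (velocity (pareto_to_half_plane \<circ> c) 0))
      \<longleftrightarrow> (\<forall>t\<in>I. c t = vector [\<alpha> t, \<beta> t]))"
proof -
  have pos: "\<alpha>\<^sub>0 > 0" "\<beta>\<^sub>0 > 0"
    using init by (auto simp: pareto_space_def)
  define s where "s = sin \<theta>\<^sub>0"
  define k where "k = cos \<theta>\<^sub>0"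
  have ks: "k\<^sup>2 = 1 - s\<^sup>2"
    by (simp add: k_def s_def cos_squared_eq)
  have \<beta>_cosh: "\<beta> t = \<beta>\<^sub>0 * (cosh t - s * sinh t)" for t
    unfolding \<beta> exp_sin_cos_half_angle s_def ..
  define \<beta>' where "\<beta>' t = \<beta>\<^sub>0 * (sinh t - s * cosh t)" for t
  have d\<beta>: "(\<beta> has_real_derivative \<beta>' t) (at t)" for t
    unfolding \<beta>_cosh[abs_def] \<beta>'_def by (auto intro!: derivative_eq_intros)
  have d\<beta>': "(\<beta>' has_real_derivative \<beta> t) (at t)" for t
    unfolding \<beta>_cosh \<beta>'_def[abs_def] by (auto intro!: derivative_eq_intros)
  have \<beta>_pos: "\<beta> t > 0" for t
    unfolding \<beta>_cosh s_def using pos(2) cosh_minus_sin_sinh_pos by simp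
  have \<beta>_nz: "\<beta> t \<noteq> 0" for t
    using \<beta>_pos[of t] by simp
  have \<alpha>_pos: "\<alpha> t > 0" for t
    using pos(1) by (simp add: \<alpha>)
  have wronskian: "cosh t * \<beta> t - sinh t * \<beta>' t = \<beta>\<^sub>0" for t
    using cosh_square_eq[of t] unfolding \<beta>_cosh \<beta>'_def by algebra
  \<comment> \<open>The numerator of the quotient rule is \<open>k\<close> times the
    Wronskian.\<close>
  have d_log: "((\<lambda>t. sinh t * k / \<beta> t) has_real_derivative \<beta>\<^sub>0 * k / (\<beta> t)\<^sup>2) (at t)" for t
    by (rule DERIV_cong[OF DERIV_divide[OF _ d\<beta> \<beta>_nz]])
      (auto intro!: derivative_eq_intros simp: power2_eq_square algebra_simps simp flip: wronskian[of t])
  define \<alpha>' where "\<alpha>' t = \<alpha> t * \<beta>\<^sub>0 * k / (\<beta> t)\<^sup>2" for t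
  have d\<alpha>: "(\<alpha> has_real_derivative \<alpha>' t) (at t)" for t
    unfolding \<alpha>[abs_def] \<alpha>'_def k_def[symmetric]
    by (rule DERIV_cong[OF DERIV_cmult[OF DERIV_chain2[OF DERIV_exp d_log]]]) simp
  \<comment> \<open>This is the acceleration prescribed by the first geodesic equation, so
    \<open>d\<alpha>'\<close> below is that equation.\<close>
  define \<alpha>'' where "\<alpha>'' t = (\<alpha>' t)\<^sup>2 / \<alpha> t - 2 * \<alpha>' t * \<beta>' t / \<beta> t" for t
  have d\<alpha>': "(\<alpha>' has_real_derivative \<alpha>'' t) (at t)" for t
  proof -
    have "((\<lambda>t. \<alpha> t * \<beta>\<^sub>0 * k / (\<beta> t)\<^sup>2) has_real_derivative \<alpha>'' t) (at t)"
      unfolding \<alpha>''_def using \<beta>_nz[of t] \<alpha>_pos[of t]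
      by (auto intro!: derivative_eq_intros d\<alpha> d\<beta>)
        (simp add: \<alpha>'_def field_simps power2_eq_square power4_eq_xxxx)
    then show ?thesis unfolding \<alpha>'_def[abs_def] .
  qed
  have speed: "(\<beta> t)\<^sup>2 * (\<alpha>' t)\<^sup>2 / (\<alpha> t)\<^sup>2 + (\<beta>' t)\<^sup>2 / (\<beta> t)\<^sup>2 = 1" for t
  proof -
    \<comment> \<open>\<beta> squared minus \<beta>' squared is constant, a conserved energy of b''
      = b.\<close>
    have "(\<beta>\<^sub>0 * k)\<^sup>2 + (\<beta>' t)\<^sup>2 = (\<beta> t)\<^sup>2"
      using cosh_square_eq[of t] ks unfolding \<beta>_cosh \<beta>'_def by algebra
    moreover have "(\<beta> t)\<^sup>2 * (\<alpha>' t)\<^sup>2 / (\<alpha> t)\<^sup>2 = (\<beta>\<^sub>0 * k)\<^sup>2 / (\<beta> t)\<^sup>2"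
      using \<beta>_nz[of t] \<alpha>_pos[of t] by (simp add: \<alpha>'_def field_simps power2_eq_square)
    ultimately show ?thesis
      using \<beta>_nz[of t] by (simp flip: add_divide_distrib)
  qed
  have at_0: "\<alpha> 0 = \<alpha>\<^sub>0" "\<beta> 0 = \<beta>\<^sub>0" "\<alpha>' 0 = \<alpha>\<^sub>0 * k / \<beta>\<^sub>0" "\<beta>' 0 = - \<beta>\<^sub>0 * s"
    using pos by (simp_all add: \<alpha> \<beta>_cosh \<alpha>'_def \<beta>'_def power2_eq_square)
  show ?thesis
  proof (intro allI impI iffI; elim conjE)

    \<comment> \<open>The closed form is a unit-speed geodesic with the prescribed initial
      data\<close>
    fix I :: "real set" and c :: "real \<Rightarrow> real ^ 2"
    assume I: "open I" "is_interval I" "0 \<in> I" and c: "\<forall>t\<in>I. c t = vector [\<alpha> t, \<beta> t]"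
    define v :: "real \<Rightarrow> real ^ 2" where "v t = vector [\<alpha>' t, \<beta>' t]" for t
    have dc: "(c has_vector_derivative v t) (at t)" if "t \<in> I" for t
      unfolding v_def
      by (rule has_vector_derivative_transform_within_open[OF
            has_vector_derivative_vector_2[OF d\<alpha> d\<beta>] I(1) that])
        (use c in auto)
    have dv: "(v has_vector_derivative vector [\<alpha>'' t, \<beta> t]) (at t)" for t
      unfolding v_def by (intro has_vector_derivative_vector_2 d\<alpha>' d\<beta>')
    have cP: "c t \<in> pareto_space" if "t \<in> I" for t
      using c that \<alpha>_pos \<beta>_pos by (simp add: pareto_space_def)
    \<comment> \<open>The unit-speed identity times \<beta>: this is the second geodesic equation,
      because \<beta>'' = \<beta>.\<close>
    have \<beta>_eq: "\<beta> t = (\<beta> t) ^ 3 / (\<alpha> t)\<^sup>2 * (\<alpha>' t)\<^sup>2 + (\<beta>' t)\<^sup>2 / \<beta> t" for t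
      using arg_cong[OF speed[of t], of "\<lambda>x. \<beta> t * x"] \<beta>_nz[of t]
      by (simp add: distrib_left power2_eq_square power3_eq_cube mult.assoc)
    have "geodesic_on pareto_space pareto_metric I c"
    proof (rule geodesic_onI[OF I(1) cP dc dv])
      fix t and j :: 2 assume t: "t \<in> I"
      have "\<forall>j. (vector [\<alpha>'' t, \<beta> t] :: real ^ 2) $ j + (\<Sum>i\<in>UNIV. \<Sum>l\<in>UNIV.
          christoffel pareto_metric (c t) j i l * v t $ i * v t $ l) = 0"
        unfolding geodesic_equations_pareto[OF cP[OF t]]
        using c t \<beta>_eq[of t] by (simp add: v_def \<alpha>''_def)
      then show "(vector [\<alpha>'' t, \<beta> t] :: real ^ 2) $ j + (\<Sum>i\<in>UNIV. \<Sum>l\<in>UNIV.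
          christoffel pareto_metric (c t) j i l * v t $ i * v t $ l) = 0"
        by blast
    qed
    moreover have "unit_speed_on pareto_metric I c"
      unfolding unit_speed_on_def metric_inner_pareto
      using c speed by (simp add: vector_derivative_at[OF dc] v_def)
    moreover have c0: "c 0 = vector [\<alpha>\<^sub>0, \<beta>\<^sub>0]"
      using c I(3) at_0 by simp
    moreover have "makes_angle \<theta>\<^sub>0 (velocity (pareto_to_half_plane \<circ> c) 0)"
      unfolding velocity_pareto_to_half_plane[OF dc[OF I(3)] cP[OF I(3)]] makes_angle_def
      \<comment> \<open>The witness is the height of the image point: a Euclidean vector has
        h-length 1 there exactly when its Euclidean length is that height.\<close>
      using pos by (intro exI[of _ "1 / \<beta>\<^sub>0"])
        (simp add: c0 v_def at_0 vec_eq_iff forall_2 power2_eq_square flip: s_def k_def)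
    ultimately show "geodesic_on pareto_space pareto_metric I c \<and> unit_speed_on pareto_metric I c \<and>
        c 0 = vector [\<alpha>\<^sub>0, \<beta>\<^sub>0] \<and> makes_angle \<theta>\<^sub>0 (velocity (pareto_to_half_plane \<circ> c) 0)"
      by blast
  next

    \<comment> \<open>Every such geodesic is given by the closed form\<close>
    fix I :: "real set" and c :: "real \<Rightarrow> real ^ 2"
    assume I: "open I" "is_interval I" "0 \<in> I"
      and geo: "geodesic_on pareto_space pareto_metric I c"
      and unit: "unit_speed_on pareto_metric I c"
      and c0: "c 0 = vector [\<alpha>\<^sub>0, \<beta>\<^sub>0]"
      and angle: "makes_angle \<theta>\<^sub>0 (velocity (pareto_to_half_plane \<circ> c) 0)"
    \<comment> \<open>Needed to pass from a vanishing derivative to constancy on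
      \<open>I\<close>.\<close>
    have conv: "convex I"
      using I(2) is_interval_convex by blast
    define v w where "v = velocity c" and "w = velocity v"
    have cP: "c t \<in> pareto_space" if "t \<in> I" for t
      using geo that by (simp add: geodesic_on_def)
    have dc: "(c has_vector_derivative v t) (at t)" and dv: "(v has_vector_derivative w t) (at t)"
      if "t \<in> I" for t
      using geo that by (auto simp: geodesic_on_def v_def w_def vector_derivative_works[symmetric])
    define a b a' b' where abs: "a t = c t $ 1" "b t = c t $ 2" "a' t = v t $ 1" "b' t = v t $ 2" for t
    have ab_pos: "a t > 0" "b t > 0" if "t \<in> I" for t
      using cP[OF that] by (auto simp: abs pareto_space_def)
    have da: "(a has_real_derivative a' t) (at t)" and db: "(b has_real_derivative b' t) (at t)"
      and da': "(a' has_real_derivative w t $ 1) (at t)" and db': "(b' has_real_derivative w t $ 2) (at t)"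
      if "t \<in> I" for t
      using has_vector_derivative_vec_nth[OF dc[OF that]] has_vector_derivative_vec_nth[OF dv[OF that]]
      by (simp_all add: abs[abs_def])
    have w: "w t $ 1 = (a' t)\<^sup>2 / a t - 2 * a' t * b' t / b t"
        "w t $ 2 = (b t) ^ 3 / (a t)\<^sup>2 * (a' t)\<^sup>2 + (b' t)\<^sup>2 / b t" if "t \<in> I" for t
    proof -
      have "\<forall>j. w t $ j + (\<Sum>i\<in>UNIV. \<Sum>l\<in>UNIV.
          christoffel pareto_metric (c t) j i l * v t $ i * v t $ l) = 0"
        using geo that by (simp add: geodesic_on_def v_def w_def)
      then show "w t $ 1 = (a' t)\<^sup>2 / a t - 2 * a' t * b' t / b t"
          "w t $ 2 = (b t) ^ 3 / (a t)\<^sup>2 * (a' t)\<^sup>2 + (b' t)\<^sup>2 / b t"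
        unfolding geodesic_equations_pareto[OF cP[OF that]] abs by blast+
    qed
    have unit: "(b t)\<^sup>2 * (a' t)\<^sup>2 / (a t)\<^sup>2 + (b' t)\<^sup>2 / (b t)\<^sup>2 = 1" if "t \<in> I" for t
      using unit that by (simp add: unit_speed_on_def metric_inner_pareto abs v_def)
    \<comment> \<open>The right-hand side of the second equation is \<open>b\<close> times the
      squared speed.\<close>
    have w2: "w t $ 2 = b t" if "t \<in> I" for t
      using arg_cong[OF unit[OF that], of "\<lambda>x. b t * x"] ab_pos[OF that]
      by (simp add: w[OF that] distrib_left power2_eq_square power3_eq_cube mult.assoc)
    have ab_0: "a 0 = \<alpha>\<^sub>0" "b 0 = \<beta>\<^sub>0"
      by (simp_all add: abs c0)
    \<comment> \<open>The angle fixes the initial velocity up to the factor \<open>r\<close>; unit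
      speed at time 0 and \<open>r > 0\<close> then force
      \<open>r = 1 / \<beta>\<^sub>0\<close>.\<close>
    obtain r where r: "r > 0" "a' 0 / \<alpha>\<^sub>0 = r * k" "- b' 0 / \<beta>\<^sub>0\<^sup>2 = r * s"
      using angle
      unfolding velocity_pareto_to_half_plane[OF dc[OF I(3)] cP[OF I(3)]] makes_angle_def
      by (auto simp: vec_eq_iff forall_2 c0 abs k_def s_def)
    have r': "a' 0 = r * k * \<alpha>\<^sub>0" "b' 0 = - (r * s * \<beta>\<^sub>0\<^sup>2)"
      using r(2,3) pos by (auto simp: field_simps)
    have "1 = (r * \<beta>\<^sub>0)\<^sup>2 * (k\<^sup>2 + s\<^sup>2)"
      using unit[OF I(3)] pos by (simp add: r' ab_0 field_simps power2_eq_square)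
    then have "r * \<beta>\<^sub>0 = 1"
      using ks r(1) pos by (simp add: power2_eq_1_iff) (smt (verit) mult_pos_pos)
    then have r_eq: "r = 1 / \<beta>\<^sub>0"
      using pos by (simp add: field_simps)
    have ab'_0: "a' 0 = \<alpha>\<^sub>0 * k / \<beta>\<^sub>0" "b' 0 = \<beta>' 0"
      using pos by (simp_all add: r' r_eq at_0 power2_eq_square)
    \<comment> \<open>The difference to \<beta> solves d'' = d with zero initial data.\<close>
    have b_eq: "b t = \<beta> t" "b' t = \<beta>' t" if "t \<in> I" for t
      using second_order_linear_unique[OF conv I(3) that, of "\<lambda>t. b t - \<beta> t" "\<lambda>t. b' t - \<beta>' t"]
        DERIV_diff[OF db d\<beta>] DERIV_diff[OF db'[unfolded w2] d\<beta>'] w2 ab_0 ab'_0 at_0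
      by auto
    \<comment> \<open>This is the g-inner product of the velocity with the Killing field \<alpha>
      d/d\<alpha>, which generates the isometries rescaling \<alpha>; its constancy follows from the
      first geodesic equation.\<close>
    have "\<exists>K. \<forall>t\<in>I. a' t / a t * (b t)\<^sup>2 = K"
    proof (intro has_field_derivative_zero_constant conv)
      fix t assume t: "t \<in> I"
      have "((\<lambda>t. a' t / a t * (b t)\<^sup>2) has_real_derivative 0) (at t)"
        using ab_pos[OF t]
        by (auto intro!: derivative_eq_intros da[OF t] db[OF t] da'[OF t])
          (simp add: w[OF t] field_simps power2_eq_square)
      then show "((\<lambda>t. a' t / a t * (b t)\<^sup>2) has_real_derivative 0) (at t within I)"
        by (rule has_field_derivative_at_within)
    qed
    then have "a' t / a t * (b t)\<^sup>2 = a' 0 / a 0 * (b 0)\<^sup>2" if "t \<in> I" for t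
      using that I(3) by metis
    \<comment> \<open>At time 0 the conserved quantity is \<open>\<beta>\<^sub>0 * k\<close>, so ln
      a has the same derivative as in \<open>d_log\<close>.\<close>
    then have log_deriv: "a' t / a t = \<beta>\<^sub>0 * k / (\<beta> t)\<^sup>2" if "t \<in> I" for t
      using that pos \<beta>_nz[of t] ab_pos[OF that]
      by (simp add: ab_0 ab'_0 b_eq field_simps power2_eq_square)
    have "\<exists>K. \<forall>t\<in>I. ln (a t) - sinh t * k / \<beta> t = K"
    proof (intro has_field_derivative_zero_constant conv)
      fix t assume t: "t \<in> I"
      have "((\<lambda>t. ln (a t)) has_real_derivative a' t / a t) (at t)"
        using ab_pos[OF t] by (auto intro!: derivative_eq_intros da[OF t])
      from DERIV_diff[OF this d_log]
      have "((\<lambda>t. ln (a t) - sinh t * k / \<beta> t) has_real_derivative 0) (at t)"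
        by (simp add: log_deriv[OF t])
      then show "((\<lambda>t. ln (a t) - sinh t * k / \<beta> t) has_real_derivative 0) (at t within I)"
        by (rule has_field_derivative_at_within)
    qed
    \<comment> \<open>Evaluating at 0, where sinh vanishes, identifies the constant as
      \<open>ln \<alpha>\<^sub>0\<close>.\<close>
    then have "ln (a t) - sinh t * k / \<beta> t = ln (a 0) - sinh 0 * k / \<beta> 0" if "t \<in> I" for t
      using that I(3) by metis
    then have "ln (a t) = ln \<alpha>\<^sub>0 + sinh t * k / \<beta> t" if "t \<in> I" for t
      using that by (simp add: ab_0 algebra_simps)
    then have "a t = \<alpha> t" if "t \<in> I" for t
      using that pos ab_pos[OF that] exp_ln[of "a t"] by (simp add: \<alpha> exp_add k_def)
    then show "\<forall>t\<in>I. c t = vector [\<alpha> t, \<beta> t]"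
      using b_eq by (auto simp: vec_eq_iff forall_2 abs)
  qed
qed

end
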